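(* Let $m\ge 1$ and let $\tau=m\tau'(m+1)\in[m+1]^l$ be a subword pattern, where the word $\tau'$ (of length $l-2$) contains neither the letter $m$ nor the letter $m+1$. Then for every $k\ge m$, \[ F_\tau(x,y;k)=\frac{1}{1-(m-1)x-x\sum_{i=m-2}^{k-2}\prod_{j=m-2}^{i}\Bigl(1-\binom{j}{m-1}x^{l-1}(1-y)\Bigr)}. \]
   Context: $[k]=\{1,\dots,k\}$ and $[k]^n$ is the set of words of length $n$ over $[k]$. A subword pattern is a word $\tau\in[p]^l$ containing every letter of $[p]$. An occurrence of $\tau$ in $\sigma=\sigma_1\cdots\sigma_n$ is an index $i$ such that the consecutive factor $\sigma_i\cdots\sigma_{i+l-1}$ is order-isomorphic to $\tau$ (same relative order and same equalities among positions). $\sigma(\tau)$ is the number of occurrences, and $F_\tau(x,y;k)=\sum_{n\ge0}\sum_{\sigma\in[k]^n}x^ny^{\sigma(\tau)}$. Binomial coefficients $\binom{j}{m-1}$ are $0$ when $0\le j<m-1$.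
   Formalization: For m = 1 the product begins at j = −1, and the binomial coefficient with upper index −1 and lower index 0 is taken to be 0; with its usual value 1 the formula fails, e.g. for τ = 12, k = 1, where F = 1/(1−x). *)

theory Defs
  imports "HOL-Computational_Algebra.Formal_Power_Series"
begin

definition words :: "nat \<Rightarrow> nat \<Rightarrow> nat list set" where
  "words k n = {\<sigma>. length \<sigma> = n \<and> set \<sigma> \<subseteq> {1..k}}"

definition subword_pattern :: "nat \<Rightarrow> nat \<Rightarrow> nat list \<Rightarrow> bool" where
  "subword_pattern p l \<tau> \<longleftrightarrow> \<tau> \<in> words p l \<and> {1..p} \<subseteq> set \<tau>"

definition order_isomorphic :: "nat list \<Rightarrow> nat list \<Rightarrow> bool" where
  "order_isomorphic u v \<longleftrightarrow> length u = length v \<and>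
     (\<forall>i<length u. \<forall>j<length u.
        (u ! i < u ! j \<longleftrightarrow> v ! i < v ! j) \<and> (u ! i = u ! j \<longleftrightarrow> v ! i = v ! j))"

text \<open>Positions are counted from 0.\<close>

definition occurrences :: "nat list \<Rightarrow> nat list \<Rightarrow> nat set" where
  "occurrences \<tau> \<sigma> =
     {i. i + length \<tau> \<le> length \<sigma> \<and> order_isomorphic (take (length \<tau>) (drop i \<sigma>)) \<tau>}"

text \<open>
  Generating functions live in \<open>\<rat>[[y]][[x]]\<close>: the outer series variable is \<open>x\<close>, and \<open>y\<close> is the
  variable of the coefficient ring.
\<close>

abbreviation gf_x :: "rat fps fps" where
  "gf_x \<equiv> fps_X"

abbreviation gf_y :: "rat fps fps" where
  "gf_y \<equiv> fps_const fps_X"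

definition subword_gf :: "nat list \<Rightarrow> nat \<Rightarrow> rat fps fps" where
  "subword_gf \<tau> k = Abs_fps (\<lambda>n. \<Sum>\<sigma>\<in>words k n. fps_X ^ card (occurrences \<tau> \<sigma>))"

text \<open>
  Binomial coefficient with an integer upper index, taken to be 0 when that index is negative;
  so \<open>binom j r = 0\<close> for every \<open>j < r\<close>. This differs from \<open>gchoose\<close>, for which
  \<open>-1\<close> over \<open>0\<close> is 1.
\<close>

definition binom :: "int \<Rightarrow> nat \<Rightarrow> nat" where
  "binom j r = (if j < 0 then 0 else nat j choose r)"

text \<open>
  The library division on \<open>rat fps fps\<close> is total; for denominators with constant term 1 it is the
  genuine reciprocal.
\<close>

lemma gf_eq_one_divide_iff:
  fixes F D :: "rat fps fps"
  assumes "fps_nth D 0 = 1"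
  shows "F = 1 / D \<longleftrightarrow> F * D = 1"
proof -
  have i1: "inverse (fps_nth D 0) = 1"
    using assms by simp
  have 1: "1 / D = inverse D"
    using fps_divide_unit[of D 1] assms by simp
  have 2: "inverse D * D = 1"
    using fps_left_inverse'[of 1 D 1] assms i1 by (simp add: fps_inverse_def)
  have 3: "F = inverse D" if "F * D = 1"
  proof -
    have "F = F * D * inverse D"
      using 2 by (simp add: mult.assoc mult.commute)
    then show ?thesis
      using that by simp
  qed
  show ?thesis
    unfolding 1 using 2 3 by blast
qed

end

theory Submission
  imports Defs
begin

text \<open>
  Two occurrences of \<open>\<tau> = m \<tau>' (m+1)\<close> overlap in at most one letter: the first letter of an
  occurrence exceeds all its inner letters, while the last one exceeds the first. Let \<open>H c\<close> be \<open>1/x\<close>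
  times the generating function of the words with first letter \<open>c\<close>. If an occurrence \<open>c u b\<close> starts
  at position 0, then \<open>u\<close> is determined by its set of \<open>m - 1\<close> letters below \<open>c\<close>, and the next possible
  occurrence starts at \<open>b\<close>. Hence
  \<open>H c = F - (c-1 choose m-1) x^(l-1) (1-y) (\<Sum>b>c. H b)\<close>,
  a triangular system, which together with \<open>F = 1 + x (\<Sum>c. H c)\<close> determines \<open>F\<close>.
\<close>

subsection \<open>Order isomorphism of words\<close>

text \<open>Equal letters of \<open>v\<close> sit at the same positions as equal letters of
  \<open>u\<close>, so a relabelling of letters is well defined, and the comparisons make it
  increasing. This replaces conditions on positions by a single map on letters.\<close>

lemma order_isomorphic_iff_map:
  "order_isomorphic u v \<longleftrightarrow> (\<exists>g. strict_mono_on (set v) g \<and> u = map g v)"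
proof
  assume iso: "order_isomorphic u v"
  \<comment> \<open>\<open>g x\<close> reads \<open>u\<close> at the first position where
    \<open>v\<close> has the letter \<open>x\<close>; by the equality clause any other such position
    gives the same value.\<close>
  define g where "g x = u ! (LEAST j. j < length v \<and> v ! j = x)" for x
  have g: "g (v ! i) = u ! i" if "i < length v" for i
  proof -
    let ?j = "LEAST j. j < length v \<and> v ! j = v ! i"
    have "?j < length v \<and> v ! ?j = v ! i"
      by (rule LeastI[of _ i]) (use that in simp)
    then show ?thesis
      using iso that by (simp add: order_isomorphic_def g_def)
  qed
  have "u = map g v"
    using iso g by (intro nth_equalityI) (auto simp: order_isomorphic_def)
  moreover have "strict_mono_on (set v) g"
    using iso g by (auto simp: strict_mono_on_def order_isomorphic_def in_set_conv_nth)
  ultimately show "\<exists>g. strict_mono_on (set v) g \<and> u = map g v"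
    by blast
next
  assume "\<exists>g. strict_mono_on (set v) g \<and> u = map g v"
  then obtain g where g: "strict_mono_on (set v) g" "u = map g v"
    by blast
  have "(g x < g y \<longleftrightarrow> x < y) \<and> (g x = g y \<longleftrightarrow> x = y)" if "x \<in> set v" "y \<in> set v" for x y
    using strict_mono_onD[OF g(1), of x y] strict_mono_onD[OF g(1), of y x] that
    by (cases x y rule: linorder_cases) auto
  then show "order_isomorphic u v"
    using g(2) by (simp add: order_isomorphic_def)
qed

text \<open>There is exactly one increasing bijection from \<open>{1..r}\<close> onto a given
  \<open>r\<close>-element set, so an isomorphic copy of \<open>t\<close> amounts to its set of
  letters.\<close>

lemma card_order_isomorphic_words:
  assumes t: "set t = {1..r}" and A: "finite A"
  shows "card {u. set u \<subseteq> A \<and> order_isomorphic u t} = card A choose r"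
proof -
  have "bij_betw set {u. set u \<subseteq> A \<and> order_isomorphic u t} {S. S \<subseteq> A \<and> card S = r}"
  proof (rule bij_betw_imageI)
    show "inj_on set {u. set u \<subseteq> A \<and> order_isomorphic u t}"
    proof (rule inj_onI)
      fix u v
      assume u: "u \<in> {u. set u \<subseteq> A \<and> order_isomorphic u t}"
        and v: "v \<in> {u. set u \<subseteq> A \<and> order_isomorphic u t}" and uv: "set u = set v"
      obtain g where g: "strict_mono_on {1..r} g" "u = map g t"
        using u t by (auto simp: order_isomorphic_iff_map)
      obtain h where h: "strict_mono_on {1..r} h" "v = map h t"
        using v t by (auto simp: order_isomorphic_iff_map)
      have eq: "g ` {1..r} = h ` {1..r}"
        using uv g(2) h(2) t by simp
      \<comment> \<open>The values of an increasing map on \<open>1, ..., r\<close> form a strictly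
        sorted list, which is determined by its set; hence \<open>g\<close> and \<open>h\<close>
        agree.\<close>
      have sorted: "sorted_wrt (<) (map f [1..<Suc r])"
        if "strict_mono_on {1..r} f" for f :: "nat \<Rightarrow> nat"
        unfolding sorted_wrt_map
        by (rule sorted_wrt_mono_rel[OF _ sorted_wrt_upt])
          (use that in \<open>auto simp: strict_mono_on_def\<close>)
      have "map g [1..<Suc r] = map h [1..<Suc r]"
        by (rule strict_sorted_equal[OF sorted[OF h(1)] sorted[OF g(1)]])
          (use eq in \<open>simp add: atLeastLessThanSuc_atLeastAtMost del: upt_Suc\<close>)
      then have "\<forall>x\<in>{1..r}. g x = h x"
        by (simp add: atLeastLessThanSuc_atLeastAtMost del: upt_Suc)
      then show "u = v"
        using g(2) h(2) t by simp
    qed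
    show "set ` {u. set u \<subseteq> A \<and> order_isomorphic u t} = {S. S \<subseteq> A \<and> card S = r}"
    proof (intro equalityI subsetI)
      fix S assume "S \<in> set ` {u. set u \<subseteq> A \<and> order_isomorphic u t}"
      then obtain g where "S \<subseteq> A" "S = g ` {1..r}" "strict_mono_on {1..r} g"
        by (auto simp: order_isomorphic_iff_map t)
      then show "S \<in> {S. S \<subseteq> A \<and> card S = r}"
        by (auto dest!: strict_mono_on_imp_inj_on simp: card_image)
    next
      fix S assume S: "S \<in> {S. S \<subseteq> A \<and> card S = r}"
      then have fin: "finite S"
        using A finite_subset by blast
      \<comment> \<open>\<open>g i\<close> is the \<open>i\<close>-th smallest element of
        \<open>S\<close>; the shift is due to list positions starting at 0.\<close>
      define g where "g i = sorted_list_of_set S ! (i - 1)" for i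
      have len: "length (sorted_list_of_set S) = r"
        using S by simp
      have mono: "strict_mono_on {1..r} g"
        unfolding strict_mono_on_def g_def
        using sorted_wrt_nth_less[OF strict_sorted_list_of_set[of S]] len by auto
      have "g ` {1..r} = S"
      proof -
        have "g ` {1..r} = (!) (sorted_list_of_set S) ` (\<lambda>i. i - 1) ` {1..r}"
          by (simp add: g_def image_image)
        also have "(\<lambda>i. i - 1) ` {1..r} = {0..<r}"
          by (auto simp: image_iff intro!: bexI[of _ "Suc _"])
        also have "(!) (sorted_list_of_set S) ` {0..<r} = set (sorted_list_of_set S)"
          using nth_image[of r "sorted_list_of_set S"] len by simp
        finally show ?thesis
          using fin by simp
      qed
      then show "S \<in> set ` {u. set u \<subseteq> A \<and> order_isomorphic u t}"
        using S mono t
        by (intro image_eqI[of _ _ "map g t"]) (auto simp: order_isomorphic_iff_map)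
    qed
  qed
  then show ?thesis
    using n_subsets[OF A] by (simp add: bij_betw_same_card)
qed

text \<open>In the pattern the first letter exceeds every inner letter and the last exceeds the
  first, so the end letters contribute only bounds. Given \<open>c\<close>, the choices of
  \<open>u\<close> and \<open>b\<close> become independent.\<close>

lemma order_isomorphic_Cons_snoc:
  assumes "set t \<subseteq> {..<m}"
  shows "order_isomorphic (c # u @ [b]) (m # t @ [Suc m]) \<longleftrightarrow>
    c < b \<and> set u \<subseteq> {..<c} \<and> order_isomorphic u t"
proof
  assume "order_isomorphic (c # u @ [b]) (m # t @ [Suc m])"
  then obtain g where g: "strict_mono_on (set (m # t @ [Suc m])) g"
    "c # u @ [b] = map g (m # t @ [Suc m])"
    unfolding order_isomorphic_iff_map by (elim exE conjE)
  then have "c = g m" "u = map g t" "b = g (Suc m)"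
    by auto
  then show "c < b \<and> set u \<subseteq> {..<c} \<and> order_isomorphic u t"
    using g(1) assms
    by (auto simp: order_isomorphic_iff_map strict_mono_on_def subset_iff)
next
  assume R: "c < b \<and> set u \<subseteq> {..<c} \<and> order_isomorphic u t"
  then obtain g where g: "strict_mono_on (set t) g" "u = map g t"
    unfolding order_isomorphic_iff_map by blast
  \<comment> \<open>Neither \<open>m\<close> nor \<open>Suc m\<close> occurs in \<open>t\<close>, so
    the overrides leave \<open>g\<close> unchanged on the inner letters.\<close>
  define h where "h = g(m := c, Suc m := b)"
  have ht: "h x = g x" "g x < c" "x < m" if "x \<in> set t" for x
    using that assms R g(2) by (auto simp: h_def)
  have "map h t = u"
    using ht g(2) by simp
  then have "c # u @ [b] = map h (m # t @ [Suc m])"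
    by (simp add: h_def)
  moreover have "strict_mono_on (set (m # t @ [Suc m])) h"
  proof (rule strict_mono_onI)
    fix x y assume "x \<in> set (m # t @ [Suc m])" "y \<in> set (m # t @ [Suc m])" "x < y"
    then consider "x \<in> set t" "y \<in> set t" | "x \<in> set t" "y = m" | "x \<in> set t" "y = Suc m"
      | "x = m" "y = Suc m"
      using ht(3) by fastforce
    then show "h x < h y"
    proof cases
      case 1
      then show ?thesis using ht g(1) \<open>x < y\<close> by (simp add: strict_mono_on_def)
    next
      case 2
      then show ?thesis using ht by (simp add: h_def)
    next
      case 3
      then have "h x < c" using ht by simp
      then show ?thesis using 3 R by (simp add: h_def)
    next
      case 4
      then show ?thesis using R by (simp add: h_def)
    qed
  qed
  ultimately show "order_isomorphic (c # u @ [b]) (m # t @ [Suc m])"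
    unfolding order_isomorphic_iff_map by (intro exI[of _ h] conjI)
qed

subsection \<open>Words and occurrences\<close>

lemma finite_words: "finite (words k n)"
  unfolding words_def using finite_lists_length_eq[of "{1..k}" n] by (simp add: conj_commute)

lemma words_0: "words k 0 = {[]}"
  by (auto simp: words_def)

lemma sum_words_Suc:
  "(\<Sum>\<sigma>\<in>words k (Suc n). f \<sigma>) = (\<Sum>c = 1..k. \<Sum>w\<in>words k n. f (c # w))"
proof -
  have "words k (Suc n) = (\<lambda>(c, w). c # w) ` ({1..k} \<times> words k n)"
    by (auto simp: words_def length_Suc_conv image_iff)
  moreover have "inj_on (\<lambda>(c, w). c # w) ({1..k} \<times> words k n)"
    by (auto simp: inj_on_def)
  ultimately have "(\<Sum>\<sigma>\<in>words k (Suc n). f \<sigma>) = (\<Sum>(c, w)\<in>{1..k} \<times> words k n. f (c # w))"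
    by (simp add: sum.reindex case_prod_unfold)
  then show ?thesis
    by (simp add: sum.cartesian_product)
qed

lemma finite_occurrences: "finite (occurrences \<tau> \<sigma>)"
  by (rule finite_subset[of _ "{..length \<sigma>}"]) (auto simp: occurrences_def)

lemma card_occurrences_Cons:
  "card (occurrences \<tau> (c # w)) =
    card (occurrences \<tau> w) + (if 0 \<in> occurrences \<tau> (c # w) then 1 else 0)"
proof -
  have "occurrences \<tau> (c # w) =
      Suc ` occurrences \<tau> w \<union> (if 0 \<in> occurrences \<tau> (c # w) then {0} else {})"
    (is "?L = ?R")
  proof (rule set_eqI)
    fix i show "i \<in> ?L \<longleftrightarrow> i \<in> ?R"
      by (cases i) (auto simp: occurrences_def)
  qed
  then have "card (occurrences \<tau> (c # w)) = card ?R"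
    by (rule arg_cong)
  also have "\<dots> = card (occurrences \<tau> w) + (if 0 \<in> occurrences \<tau> (c # w) then 1 else 0)"
    by (subst card_Un_disjoint) (auto simp: finite_occurrences card_image)
  finally show ?thesis .
qed

text \<open>An occurrence starting inside \<open>u\<close> would have \<open>b\<close> as an inner
  letter, hence smaller than its first letter. But that first letter lies in \<open>u\<close>, below
  \<open>c < b\<close>.\<close>

lemma card_occurrences_skip:
  assumes t: "set t \<subseteq> {..<m}" and \<tau>: "\<tau> = m # t @ [Suc m]"
    and iso: "order_isomorphic (c # u @ [b]) \<tau>"
  shows "card (occurrences \<tau> (u @ b # v)) = card (occurrences \<tau> (b # v))"
proof -
  have len: "length u = length t" "length \<tau> = length t + 2"
    using iso by (auto simp: \<tau> order_isomorphic_def)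
  have u: "c < b" "set u \<subseteq> {..<c}"
    using iso unfolding \<tau> order_isomorphic_Cons_snoc[OF t] by auto
  have late: "length u \<le> i" if i: "i \<in> occurrences \<tau> (u @ b # v)" for i
  proof (rule ccontr)
    assume "\<not> length u \<le> i"
    then have less: "i < length u" by simp
    define w where "w = take (length \<tau>) (drop i (u @ b # v))"
    have "order_isomorphic w \<tau>" "i + length \<tau> \<le> length (u @ b # v)"
      using i by (auto simp: occurrences_def w_def)
    \<comment> \<open>The offset \<open>length u - i\<close> lies between 1 and
      \<open>length t\<close>, so it points to an inner letter of the pattern.\<close>
    moreover have "\<tau> ! (length u - i) < \<tau> ! 0"
    proof -
      have "\<tau> ! (length u - i) = t ! (length u - i - 1)"
        using less len by (auto simp: \<tau> nth_append nth_Cons')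
      moreover have "t ! (length u - i - 1) \<in> set t"
        using less len by (intro nth_mem) auto
      ultimately show ?thesis
        using t by (auto simp: \<tau>)
    qed
    moreover have "length u - i < length w" "0 < length w"
      using less len calculation(2) by (auto simp: w_def)
    ultimately have "w ! (length u - i) < w ! 0"
      by (auto simp: order_isomorphic_def)
    moreover have "w ! (length u - i) = b" "w ! 0 = u ! i"
      using less len calculation by (auto simp: w_def nth_append)
    moreover have "u ! i < c"
      using u(2) less nth_mem by blast
    ultimately show False
      using u(1) by simp
  qed
  have "occurrences \<tau> (u @ b # v) = (+) (length u) ` occurrences \<tau> (b # v)"
  proof (intro equalityI subsetI)
    fix i assume i: "i \<in> occurrences \<tau> (u @ b # v)"
    show "i \<in> (+) (length u) ` occurrences \<tau> (b # v)"
      using i late[OF i]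
      by (intro image_eqI[of _ _ "i - length u"]) (auto simp: occurrences_def)
  qed (auto simp: occurrences_def)
  then show ?thesis
    by (simp add: card_image)
qed

text \<open>Such a \<open>w\<close> splits uniquely as \<open>u @ b # v\<close>. As \<open>f\<close>
  forgets \<open>u\<close>, the inner words contribute only their number, a binomial
  coefficient.\<close>

lemma sum_words_occurrence_at_0:
  fixes f :: "nat list \<Rightarrow> 'a::comm_semiring_1"
  assumes t: "set t = {1..<m}" and \<tau>: "\<tau> = m # t @ [Suc m]" and c: "c \<in> {1..k}"
    and skip: "\<And>u b v. order_isomorphic (c # u @ [b]) \<tau> \<Longrightarrow> f (u @ b # v) = f (b # v)"
  shows "(\<Sum>w | w \<in> words k n \<and> 0 \<in> occurrences \<tau> (c # w). f w) =
    (if n < length t + 1 then 0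
     else of_nat (c - 1 choose (m - 1)) *
       (\<Sum>b\<in>{c<..k}. \<Sum>v\<in>words k (n - (length t + 1)). f (b # v)))"
proof (cases "n < length t + 1")
  case True
  then have "{w. w \<in> words k n \<and> 0 \<in> occurrences \<tau> (c # w)} = {}"
    by (auto simp: words_def occurrences_def \<tau>)
  then show ?thesis
    using True by (simp only: sum.empty if_True)
next
  case False
  \<comment> \<open>The inner words \<open>u\<close>: they use \<open>m - 1\<close> distinct letters
    among the \<open>c - 1\<close> letters below \<open>c\<close>.\<close>
  define U where "U = {u. set u \<subseteq> {1..<c} \<and> order_isomorphic u t}"
  have card_U: "card U = c - 1 choose (m - 1)"
  proof -
    have "set t = {1..m - 1}"
      unfolding t by auto
    from card_order_isomorphic_words[OF this, of "{1..<c}"] show ?thesis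
      by (simp add: U_def)
  qed
  have t': "set t \<subseteq> {..<m}"
    using t by auto
  note iso = order_isomorphic_Cons_snoc[OF t', folded \<tau>]
  let ?V = "words k (n - (length t + 1))"
  let ?f = "\<lambda>(u, b, v). u @ b # v"
  have len_U: "length u = length t" if "u \<in> U" for u
    using that by (auto simp: U_def order_isomorphic_def)
  have "{w. w \<in> words k n \<and> 0 \<in> occurrences \<tau> (c # w)} = ?f ` (U \<times> {c<..k} \<times> ?V)"
  proof (intro equalityI subsetI)
    fix w assume w: "w \<in> {w. w \<in> words k n \<and> 0 \<in> occurrences \<tau> (c # w)}"
    define u b v where "u = take (length t) w" and "b = w ! length t"
      and "v = drop (Suc (length t)) w"
    have len: "length w = n"
      using w by (simp add: words_def)
    then have weq: "w = u @ b # v"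
      using False by (simp add: u_def b_def v_def id_take_nth_drop)
    have lu: "length u = length t"
      using False len by (simp add: u_def)
    have "order_isomorphic (c # u @ [b]) \<tau>"
      using w lu by (simp add: occurrences_def weq \<tau>)
    moreover have "set w \<subseteq> {1..k}"
      using w by (simp add: words_def)
    ultimately have "u \<in> U" "b \<in> {c<..k}" "v \<in> ?V"
      using len lu by (auto simp: iso U_def words_def weq subset_iff)
    then show "w \<in> ?f ` (U \<times> {c<..k} \<times> ?V)"
      using weq by (intro image_eqI[of _ _ "(u, b, v)"]) auto
  next
    fix w assume "w \<in> ?f ` (U \<times> {c<..k} \<times> ?V)"
    then obtain u b v where *: "w = u @ b # v" "u \<in> U" "b \<in> {c<..k}" "v \<in> ?V"
      by auto
    then have "order_isomorphic (c # u @ [b]) \<tau>"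
      by (auto simp: iso U_def)
    then show "w \<in> {w. w \<in> words k n \<and> 0 \<in> occurrences \<tau> (c # w)}"
      using * False c len_U[of u] by (auto simp: U_def words_def occurrences_def \<tau>)
  qed
  \<comment> \<open>All words of \<open>U\<close> have the same length, which fixes the place of the
    split.\<close>
  moreover have "inj_on ?f (U \<times> {c<..k} \<times> ?V)"
    by (auto simp: inj_on_def len_U)
  ultimately have "(\<Sum>w | w \<in> words k n \<and> 0 \<in> occurrences \<tau> (c # w). f w) =
      (\<Sum>(u, b, v)\<in>U \<times> {c<..k} \<times> ?V. f (u @ b # v))"
    by (simp add: sum.reindex case_prod_unfold)
  also have "\<dots> = (\<Sum>(u, b, v)\<in>U \<times> {c<..k} \<times> ?V. f (b # v))"
    by (intro sum.cong refl) (fastforce simp: U_def iso intro!: skip)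
  also have "\<dots> = (\<Sum>u\<in>U. \<Sum>(b, v)\<in>{c<..k} \<times> ?V. f (b # v))"
    by (rule sum.cartesian_product[symmetric])
  also have "\<dots> = of_nat (card U) * (\<Sum>b\<in>{c<..k}. \<Sum>v\<in>?V. f (b # v))"
    by (simp add: sum.cartesian_product)
  finally show ?thesis
    using False by (simp add: card_U)
qed

subsection \<open>The generating function\<close>

text \<open>For the tails \<open>T j\<close>, the sums of \<open>H b\<close> over
  \<open>b > j\<close>, the equation for letter \<open>j + 1\<close> reads
  \<open>T j = F + (1 - a (j + 1)) * T (j + 1)\<close>; unrolling it from \<open>j = 0\<close> to
  \<open>k\<close> yields the product sum.\<close>

lemma triangular_system_sum:
  fixes H a :: "nat \<Rightarrow> 'a::comm_ring_1"
  assumes "\<And>c. c \<in> {1..k} \<Longrightarrow> H c = F - a c * (\<Sum>b\<in>{c<..k}. H b)"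
  shows "(\<Sum>c = 1..k. H c) = F * (\<Sum>c = 1..k. \<Prod>i = 1..<c. 1 - a i)"
proof -
  \<comment> \<open>The state after unrolling \<open>j\<close> equations; at \<open>j = k\<close>
    the remaining tail is empty.\<close>
  have "(\<Sum>c = 1..k. H c) =
      F * (\<Sum>c = 1..j. \<Prod>i = 1..<c. 1 - a i) + (\<Prod>i = 1..j. 1 - a i) * (\<Sum>b\<in>{j<..k}. H b)"
    if "j \<le> k" for j
    using that
  proof (induction j)
    case 0
    have "{0<..k} = {1..k}" by auto
    then show ?case by simp
  next
    case (Suc j)
    have "{j<..k} = insert (Suc j) {Suc j<..k}"
      using Suc.prems by auto
    then have "(\<Sum>b\<in>{j<..k}. H b) = F + (1 - a (Suc j)) * (\<Sum>b\<in>{Suc j<..k}. H b)"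
      using assms[of "Suc j"] Suc.prems by (simp add: algebra_simps)
    moreover have "{1..<Suc j} = {1..j}"
      by auto
    ultimately show ?case
      using Suc.IH Suc.prems by (simp add: distrib_left mult.assoc)
  qed
  from this[of k] show ?thesis
    by simp
qed

text \<open>The recurrence for \<open>H\<close> solved for the generating function, with one summand
  for each first letter \<open>c\<close>; the product form avoids division of power series.\<close>

lemma subword_gf_mult:
  assumes t: "set t = {1..<m}" and \<tau>: "\<tau> = m # t @ [Suc m]"
  shows "subword_gf \<tau> k * (1 - gf_x * (\<Sum>c = 1..k. \<Prod>i = 1..<c.
    1 - of_nat (i - 1 choose (m - 1)) * gf_x ^ (length \<tau> - 1) * (1 - gf_y))) = 1"
proof -
  \<comment> \<open>Here \<open>fps_X\<close> lives in the coefficient ring, so it is the variable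
    y.\<close>
  define wt :: "nat list \<Rightarrow> rat fps" where "wt \<sigma> = fps_X ^ card (occurrences \<tau> \<sigma>)" for \<sigma>
  define h where "h c n = (\<Sum>w\<in>words k n. wt (c # w))" for c n
  define H where "H c = Abs_fps (h c)" for c
  let ?F = "subword_gf \<tau> k"
  let ?a = "\<lambda>i. of_nat (i - 1 choose (m - 1)) * gf_x ^ (length \<tau> - 1) * (1 - gf_y)"
  have len: "length \<tau> - 1 = length t + 1"
    by (simp add: \<tau>)
  have F_nth: "fps_nth ?F n = (\<Sum>w\<in>words k n. wt w)" for n
    by (simp add: subword_gf_def wt_def)
  have F_H: "?F = 1 + gf_x * (\<Sum>c = 1..k. H c)"
  proof (rule fps_ext)
    fix n
    show "fps_nth ?F n = fps_nth (1 + gf_x * (\<Sum>c = 1..k. H c)) n"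
    proof (cases n)
      case 0
      have "occurrences \<tau> [] = {}"
        by (auto simp: occurrences_def \<tau>)
      then show ?thesis
        using 0 by (simp add: F_nth words_0 wt_def)
    next
      case (Suc n')
      then show ?thesis
        by (simp add: F_nth sum_words_Suc H_def h_def fps_sum_nth)
    qed
  qed
  \<comment> \<open>A new occurrence at position 0 turns y^e into y^(e+1) = y^e + (y - 1)
    y^e.\<close>
  have wt_Cons: "wt (c # w) =
      wt w + (if 0 \<in> occurrences \<tau> (c # w) then (fps_X - 1) * wt w else 0)" for c w
    unfolding wt_def card_occurrences_Cons by (simp add: algebra_simps)
  have skip: "wt (u @ b # v) = wt (b # v)" if "order_isomorphic (c # u @ [b]) \<tau>" for c u b v
  proof -
    have "set t \<subseteq> {..<m}"
      using t by auto
    from card_occurrences_skip[OF this \<tau> that] show ?thesis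
      by (simp add: wt_def)
  qed
  \<comment> \<open>The recurrence for \<open>H c\<close>, coefficient by coefficient; the case
    distinction on \<open>n\<close> is the effect of multiplying by x^(l-1).\<close>
  have h: "h c n = fps_nth ?F n + (fps_X - 1) * (if n < length t + 1 then 0
     else of_nat (c - 1 choose (m - 1)) * (\<Sum>b\<in>{c<..k}. h b (n - (length t + 1))))"
    if "c \<in> {1..k}" for c n
  proof -
    have "h c n = (\<Sum>w\<in>words k n. wt w) +
        (\<Sum>w\<in>words k n. if 0 \<in> occurrences \<tau> (c # w) then (fps_X - 1) * wt w else 0)"
      unfolding h_def wt_Cons sum.distrib ..
    also have "(\<Sum>w\<in>words k n. if 0 \<in> occurrences \<tau> (c # w) then (fps_X - 1) * wt w else 0) =
        (fps_X - 1) * (\<Sum>w | w \<in> words k n \<and> 0 \<in> occurrences \<tau> (c # w). wt w)"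
      by (simp add: sum.inter_filter[OF finite_words] sum_distrib_left if_distrib cong: if_cong)
    also have "(\<Sum>w | w \<in> words k n \<and> 0 \<in> occurrences \<tau> (c # w). wt w) =
        (if n < length t + 1 then 0
         else of_nat (c - 1 choose (m - 1)) * (\<Sum>b\<in>{c<..k}. h b (n - (length t + 1))))"
      unfolding h_def by (rule sum_words_occurrence_at_0[OF t \<tau> that]) (rule skip)
    finally show ?thesis
      unfolding F_nth .
  qed
  have "H c = ?F - ?a c * (\<Sum>b\<in>{c<..k}. H b)" if "c \<in> {1..k}" for c
  proof -
    \<comment> \<open>The power of x is moved to the front and the rest of the factor into a
      constant, so that taking coefficients gives the shift and cutoff of \<open>h\<close>.\<close>
    have "?F - ?a c * (\<Sum>b\<in>{c<..k}. H b) = ?F +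
        gf_x ^ (length t + 1) *
          (fps_const ((fps_X - 1) * of_nat (c - 1 choose (m - 1))) * (\<Sum>b\<in>{c<..k}. H b))"
      unfolding len
      by (simp add: algebra_simps fps_of_nat[symmetric]
          flip: fps_const_mult fps_const_sub)
    moreover have "fps_nth (H c) n = fps_nth (?F +
        gf_x ^ (length t + 1) *
          (fps_const ((fps_X - 1) * of_nat (c - 1 choose (m - 1))) * (\<Sum>b\<in>{c<..k}. H b))) n"
      for n
      using h[OF that, of n]
      by (simp add: H_def fps_X_power_mult_nth fps_sum_nth mult.assoc del: power_Suc)
    ultimately show ?thesis
      by (metis fps_ext)
  qed
  from triangular_system_sum[of k H ?F ?a, OF this]
  have "(\<Sum>c = 1..k. H c) = ?F * (\<Sum>c = 1..k. \<Prod>i = 1..<c. 1 - ?a i)" .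
  with F_H have "?F = 1 + gf_x * (?F * (\<Sum>c = 1..k. \<Prod>i = 1..<c. 1 - ?a i))"
    by simp
  then show ?thesis
    by (simp add: algebra_simps)
qed

text \<open>Summands with \<open>c < m\<close> have only factors 1 because their binomials vanish,
  which gives \<open>m - 1\<close>; the others are reindexed by \<open>i = c - 2\<close> and
  \<open>j = i - 1\<close> in sum and product respectively. Integer indices are needed since
  \<open>m - 2\<close> is -1 for \<open>m = 1\<close>.\<close>

lemma sum_prod_shift_index:
  fixes g :: "nat \<Rightarrow> 'a::comm_ring_1"
  assumes m: "1 \<le> m" "m \<le> k" and g0: "g 0 = 0"
  shows "(\<Sum>c = 1..k. \<Prod>i = 1..<c. 1 - g (i - 1 choose (m - 1))) =
    of_nat (m - 1) +
      (\<Sum>i = int m - 2..int k - 2. \<Prod>j = int m - 2..i. 1 - g (binom j (m - 1)))"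
proof -
  let ?P = "\<lambda>c. \<Prod>i = 1..<c. 1 - g (i - 1 choose (m - 1))"
  have "{1..k} = {1..<m} \<union> {m..k}"
    using m by auto
  then have "(\<Sum>c = 1..k. ?P c) = (\<Sum>c = 1..<m. ?P c) + (\<Sum>c = m..k. ?P c)"
    by (simp add: sum.union_disjoint ivl_disj_int)
  also have "(\<Sum>c = 1..<m. ?P c) = (\<Sum>c = 1..<m. 1)"
    by (intro sum.cong refl prod.neutral) (auto simp: g0 binomial_eq_0)
  also have "\<dots> = of_nat (m - 1)"
    by simp
  also have "(\<Sum>c = m..k. ?P c) =
      (\<Sum>i = int m - 2..int k - 2. \<Prod>j = int m - 2..i. 1 - g (binom j (m - 1)))"
  proof (rule sum.reindex_bij_witness[of _ "\<lambda>i. nat (i + 2)" "\<lambda>c. int c - 2"])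
    fix c assume c: "c \<in> {m..k}"
    have "?P c = (\<Prod>j = 0..int c - 2. 1 - g (binom j (m - 1)))"
      by (rule prod.reindex_bij_witness[of _ "\<lambda>j. nat (j + 1)" "\<lambda>i. int i - 1"])
        (auto simp: binom_def nat_diff_distrib)
    \<comment> \<open>The value -1 is the least possible \<open>m - 2\<close>. Its factor is 1 by
      the convention for negative upper indices, so the range can be enlarged here and cut down to
      start at \<open>m - 2\<close> next.\<close>
    also have "\<dots> = (\<Prod>j = -1..int c - 2. 1 - g (binom j (m - 1)))"
      by (rule prod.mono_neutral_left) (auto simp: binom_def g0)
    also have "\<dots> = (\<Prod>j = int m - 2..int c - 2. 1 - g (binom j (m - 1)))"
      using m by (intro prod.mono_neutral_right) (auto simp: binom_def g0 binomial_eq_0)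
    finally show "(\<Prod>j = int m - 2..int c - 2. 1 - g (binom j (m - 1))) = ?P c" ..
  qed (use m in auto)
  finally show ?thesis .
qed

theorem theorem2p11:
  fixes m l k :: nat and \<tau> \<tau>' :: "nat list"
  assumes "m \<ge> 1"
    and "subword_pattern (m + 1) l \<tau>"
    and "\<tau> = m # \<tau>' @ [m + 1]"
    and "m \<notin> set \<tau>'" and "m + 1 \<notin> set \<tau>'"
    and "k \<ge> m"
  shows "subword_gf \<tau> k =
    1 / (1 - of_nat (m - 1) * gf_x
         - gf_x * (\<Sum>i = int m - 2..int k - 2. \<Prod>j = int m - 2..i.
             (1 - of_nat (binom j (m - 1)) * gf_x ^ (l - 1) * (1 - gf_y))))"
proof -
  have l: "length \<tau> = l"
    and sub: "set \<tau> \<subseteq> {1..m + 1}" "{1..m + 1} \<subseteq> set \<tau>"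
    using assms(2) by (auto simp: subword_pattern_def words_def)
  \<comment> \<open>All letters of \<open>[m+1]\<close> occur and the two largest are excluded from
    \<tau>', so it uses exactly the remaining ones.\<close>
  have t: "set \<tau>' = {1..<m}"
  proof (intro equalityI subsetI)
    fix x assume "x \<in> set \<tau>'"
    then have "x \<in> {1..m + 1}" "x \<noteq> m" "x \<noteq> m + 1"
      using sub(1) assms(3-5) by auto
    then show "x \<in> {1..<m}" by auto
  next
    fix x assume x: "x \<in> {1..<m}"
    then have "x \<in> set \<tau>" using sub(2) by auto
    then show "x \<in> set \<tau>'" using x assms(3) by auto
  qed
  have \<tau>: "\<tau> = m # \<tau>' @ [Suc m]"
    using assms(3) by simp
  define S where "S = (\<Sum>i = int m - 2..int k - 2. \<Prod>j = int m - 2..i.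
    (1 - of_nat (binom j (m - 1)) * gf_x ^ (l - 1) * (1 - gf_y)))"
  have "subword_gf \<tau> k * (1 - gf_x * (of_nat (m - 1) + S)) = 1"
    using subword_gf_mult[OF t \<tau>, of k]
      sum_prod_shift_index[OF assms(1,6), of "\<lambda>r. of_nat r * gf_x ^ (l - 1) * (1 - gf_y)"]
    by (simp add: S_def l)
  then have "subword_gf \<tau> k * (1 - of_nat (m - 1) * gf_x - gf_x * S) = 1"
    by (simp add: algebra_simps)
  \<comment> \<open>Constant term 1 makes the total division a true reciprocal.\<close>
  moreover have "fps_nth (1 - of_nat (m - 1) * gf_x - gf_x * S) 0 = 1"
    by simp
  ultimately show ?thesis
    unfolding S_def[symmetric] by (simp only: gf_eq_one_divide_iff)
qed

end
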